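(* Let $A$ be an algebra with a fixed basis. If either $G_R(A)$ or $G_L(A)$ has no oriented cycles, then the derived series of $A$ converges to $\{0\}$, i.e. $A^{[t]}=\{0\}$ for some $t$. In particular, if $A$ is a Leibniz algebra, then $A$ is solvable.
   Context: $\mathbb{F}$ is an algebraically closed field of characteristic zero; an algebra is a finite-dimensional $\mathbb{F}$-vector space $A$ with a bilinear product $*$. For a basis $\{x_1,\dots,x_n\}$ write $x_i*x_j=\sum_l c_{ij}^l x_l$. $G_R(A)$ has vertices $x_1,\dots,x_n$ and an arrow $x_i\to x_l$ iff $c_{ij}^l\ne0$ for some $j$; $G_L(A)$ has vertices $x_1,\dots,x_n$ and an arrow $x_j\to x_l$ iff $c_{ij}^l\ne0$ for some $i$. An oriented cycle is a closed directed walk (loops count). The derived series is $A^{[1]}=A$, $A^{[s+1]}=A^{[s]}*A^{[s]}$ (span of products). A Leibniz algebra satisfies $(x*y)*z-(x*z)*y-x*(y*z)=0$; it is solvable if $A^{[t]}=0$ for some $t$. *)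

theory Defs
  imports
    "HOL-Computational_Algebra.Polynomial"
    "Graph_Theory.Pair_Digraph"
begin

text \<open>
  A finite-dimensional, not necessarily associative algebra with a fixed finite basis: the
  underlying vector space is the whole type \<open>'v\<close>, and \<open>Basis\<close> is the set
  \<open>{x\<^sub>1, \<dots>, x\<^sub>n}\<close>.
\<close>
locale based_algebra = finite_dimensional_vector_space scale Basis
  for scale :: "'k::field \<Rightarrow> 'v::ab_group_add \<Rightarrow> 'v"
    and Basis :: "'v set" +
  fixes mult :: "'v \<Rightarrow> 'v \<Rightarrow> 'v"  (infixl "\<star>" 70)
  assumes linear_mult_right: "\<And>x. Vector_Spaces.linear scale scale (\<lambda>y. x \<star> y)"
    and linear_mult_left: "\<And>y. Vector_Spaces.linear scale scale (\<lambda>x. x \<star> y)"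
begin

text \<open>For basis vectors \<open>x\<close>, \<open>y\<close>, \<open>z\<close>, this is the coefficient of \<open>z\<close> in \<open>x \<star> y\<close>.\<close>
definition struct_const :: "'v \<Rightarrow> 'v \<Rightarrow> 'v \<Rightarrow> 'k" where
  "struct_const x y z = representation Basis (x \<star> y) z"

definition graph_R :: "'v pair_pre_digraph" where
  "graph_R = \<lparr> pverts = Basis,
     parcs = {(x, z). x \<in> Basis \<and> z \<in> Basis \<and> (\<exists>y\<in>Basis. struct_const x y z \<noteq> 0)} \<rparr>"

definition graph_L :: "'v pair_pre_digraph" where
  "graph_L = \<lparr> pverts = Basis,
     parcs = {(y, z). y \<in> Basis \<and> z \<in> Basis \<and> (\<exists>x\<in>Basis. struct_const x y z \<noteq> 0)} \<rparr>"

text \<open>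
  The numbering starts at 1; the value at 0 is a dummy, and statements about the series
  restrict the index to be at least 1.
\<close>
fun derived_series :: "nat \<Rightarrow> 'v set" where
  "derived_series 0 = UNIV"
| "derived_series (Suc 0) = UNIV"
| "derived_series (Suc (Suc s)) =
     span {x \<star> y | x y. x \<in> derived_series (Suc s) \<and> y \<in> derived_series (Suc s)}"

definition solvable :: bool where
  "solvable \<longleftrightarrow> (\<exists>t\<ge>1. derived_series t = {0})"

definition leibniz :: bool where
  "leibniz \<longleftrightarrow> (\<forall>x y z. (x \<star> y) \<star> z - (x \<star> z) \<star> y - x \<star> (y \<star> z) = 0)"

end

text \<open>
  An oriented cycle is a closed directed walk with at least one arc; unlike for
  \<^term>\<open>pre_digraph.cycle\<close>, vertices may be repeated.
\<close>
definition has_oriented_cycle :: "'a pair_pre_digraph \<Rightarrow> bool" where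
  "has_oriented_cycle G \<longleftrightarrow> (\<exists>p. wf_digraph.closed_w (with_proj G) p)"

end

theory Submission
  imports Defs
begin

text \<open>
  Let \<open>S\<^sub>0\<close> be the basis and \<open>S\<^bsub>t+1\<^esub>\<close> the set of heads of arrows with tail in
  \<open>S\<^sub>t\<close>. Then \<open>A\<^bsup>[t+1]\<^esup>\<close> lies in the span of \<open>S\<^sub>t\<close>, because the product of two vectors in the
  span of \<open>S\<close> only involves heads of arrows starting in \<open>S\<close>. Without oriented cycles, a
  nonempty \<open>S\<^sub>t\<close> has a vertex with no predecessor in \<open>S\<^sub>t\<close>, so the \<open>S\<^sub>t\<close> strictly decrease
  until they are empty.
\<close>

lemma acyclic_iterated_Image_empty:
  assumes "finite B" "E \<subseteq> B \<times> B" "acyclic E"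
  shows "((``) E ^^ card B) B = {}"
proof -
  let ?S = "\<lambda>t. ((``) E ^^ t) B"
  \<comment> \<open>The base case is the inclusion of heads in \<open>B\<close>; monotonicity of the
    image carries it to every later step.\<close>
  have decr: "?S (Suc t) \<subseteq> ?S t" for t
  proof (induction t)
    case 0
    then show ?case using assms(2) by auto
  next
    case (Suc t)
    then show ?case by (auto simp: Image_mono)
  qed
  have sub: "?S t \<subseteq> B" for t
    using assms(2) by (cases t) auto
  have "wf E"
    using assms by (meson finite_SigmaI finite_acyclic_wf finite_subset)
  have strict: "?S (Suc t) \<subset> ?S t" if ne: "?S t \<noteq> {}" for t
  proof -
    obtain z where "z \<in> ?S t" "\<And>y. (y, z) \<in> E \<Longrightarrow> y \<notin> ?S t"
      using wfE_min'[OF \<open>wf E\<close> ne] by blast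
    then have "z \<notin> ?S (Suc t)" by auto
    with \<open>z \<in> ?S t\<close> decr show ?thesis by blast
  qed
  \<comment> \<open>Every step from a nonempty set loses at least one vertex, so the sum cannot
    grow. At \<open>t = card B\<close> the second alternative also forces cardinality 0.\<close>
  have "?S t = {} \<or> card (?S t) + t \<le> card B" for t
  proof (induction t)
    case 0
    then show ?case by simp
  next
    case (Suc t)
    show ?case
    proof (cases "?S t = {}")
      case True
      then show ?thesis by simp
    next
      case False
      have "card (?S (Suc t)) < card (?S t)"
        using strict[OF False] sub assms(1) by (meson finite_subset psubset_card_mono)
      with Suc False show ?thesis by linarith
    qed
  qed
  from this[of "card B"] show ?thesis
    using sub[of "card B"] assms(1) by (auto dest: finite_subset)
qed

text \<open>A pair in the transitive closure of the arcs is joined by a nonempty walk, so a pair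
  \<open>(u, u)\<close> there would give a closed walk, loops included.\<close>

lemma acyclic_parcs_if_no_oriented_cycle:
  assumes "pair_wf_digraph G" "\<not> has_oriented_cycle G"
  shows "acyclic (parcs G)"
proof -
  interpret pair_wf_digraph G by fact
  have "\<not> (\<exists>u p. awalk u p u \<and> p \<noteq> [])"
    using assms(2) by (auto simp: has_oriented_cycle_def closed_w_def)
  then show ?thesis
    using reachable1_awalk unfolding acyclic_def by auto
qed

context based_algebra
begin

lemma pair_wf_digraph_graph_R: "pair_wf_digraph graph_R"
  by unfold_locales (auto simp: graph_R_def)

lemma pair_wf_digraph_graph_L: "pair_wf_digraph graph_L"
  by unfold_locales (auto simp: graph_L_def)

text \<open>Bilinearity reduces the claim to generators: first the right factor is extended from
  \<open>Y\<close> to its span with the left one fixed in \<open>X\<close>, then the left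
  factor.\<close>

lemma mult_mem_span:
  assumes "\<And>x y. x \<in> X \<Longrightarrow> y \<in> Y \<Longrightarrow> x \<star> y \<in> span Z"
    and "x \<in> span X" "y \<in> span Y"
  shows "x \<star> y \<in> span Z"
proof -
  interpret R: Vector_Spaces.linear scale scale "\<lambda>y. u \<star> y" for u
    by (rule linear_mult_right)
  interpret L: Vector_Spaces.linear scale scale "\<lambda>x. x \<star> u" for u
    by (rule linear_mult_left)
  have right: "u \<star> y \<in> span Z" if "u \<in> X" for u
    using \<open>y \<in> span Y\<close>
  proof (induction rule: span_induct_alt)
    case base
    then show ?case by (simp add: R.zero span_zero)
  next
    case (step c b v)
    then show ?case using that assms(1) by (simp add: R.add R.scale span_add span_scale)
  qed
  show ?thesis
    using \<open>x \<in> span X\<close>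
  proof (induction rule: span_induct_alt)
    case base
    then show ?case by (simp add: L.zero span_zero)
  next
    case (step c b v)
    then show ?case using right by (simp add: L.add L.scale span_add span_scale)
  qed
qed

lemma mult_mem_span_struct_const:
  "x \<star> y \<in> span {z \<in> Basis. struct_const x y z \<noteq> 0}"
proof -
  let ?f = "\<lambda>z. scale (struct_const x y z) z"
  have eq: "(\<Sum>z | struct_const x y z \<noteq> 0. ?f z) = x \<star> y"
    unfolding struct_const_def
    by (rule sum_nonzero_representation_eq) (simp_all add: independent_Basis span_Basis)
  \<comment> \<open>The sum ranges over all vectors, but a nonzero coefficient occurs only at a
    basis vector.\<close>
  have "(\<Sum>z | struct_const x y z \<noteq> 0. ?f z) \<in> span {z \<in> Basis. struct_const x y z \<noteq> 0}"
    by (intro span_sum span_scale span_base)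
      (auto simp: struct_const_def dest: representation_ne_zero)
  then show ?thesis by (simp only: eq)
qed

text \<open>For basis vectors \<open>x\<close>, \<open>y\<close> in \<open>S\<close>, each
  \<open>z\<close> occurring in their product is the head of an arrow from the left factor
  \<open>x\<close>, with \<open>y\<close> as the witness in \<open>graph_R\<close>.\<close>

lemma mult_mem_span_graph_R:
  assumes "S \<subseteq> Basis" "x \<in> span S" "y \<in> span S"
  shows "x \<star> y \<in> span (parcs graph_R `` S)"
proof (rule mult_mem_span[OF _ assms(2,3)])
  fix x y assume "x \<in> S" "y \<in> S"
  then have "{z \<in> Basis. struct_const x y z \<noteq> 0} \<subseteq> parcs graph_R `` S"
    using assms(1) by (auto simp: graph_R_def)
  then show "x \<star> y \<in> span (parcs graph_R `` S)"
    using mult_mem_span_struct_const span_mono by blast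
qed

text \<open>Here the arrow starts at the right factor \<open>y\<close>, and \<open>x\<close> is the
  witness.\<close>

lemma mult_mem_span_graph_L:
  assumes "S \<subseteq> Basis" "x \<in> span S" "y \<in> span S"
  shows "x \<star> y \<in> span (parcs graph_L `` S)"
proof (rule mult_mem_span[OF _ assms(2,3)])
  fix x y assume "x \<in> S" "y \<in> S"
  then have "{z \<in> Basis. struct_const x y z \<noteq> 0} \<subseteq> parcs graph_L `` S"
    using assms(1) by (auto simp: graph_L_def)
  then show "x \<star> y \<in> span (parcs graph_L `` S)"
    using mult_mem_span_struct_const span_mono by blast
qed

text \<open>The relation \<open>E\<close> stands for the arcs of either graph, so that one induction
  serves both.\<close>

lemma derived_series_eq_zero_if_acyclic:
  assumes "E \<subseteq> Basis \<times> Basis" "acyclic E"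
    and mult_E: "\<And>S x y. S \<subseteq> Basis \<Longrightarrow> x \<in> span S \<Longrightarrow> y \<in> span S \<Longrightarrow> x \<star> y \<in> span (E `` S)"
  shows "derived_series (Suc (card Basis)) = {0}"
proof -
  have sub: "((``) E ^^ t) Basis \<subseteq> Basis" for t
    using assms(1) by (cases t) auto
  \<comment> \<open>The series is numbered from 1 and the iterated images from 0, hence the shift by
    one.\<close>
  have "derived_series (Suc t) \<subseteq> span (((``) E ^^ t) Basis)" for t
  proof (induction t)
    case 0
    then show ?case by (simp add: span_Basis)
  next
    case (Suc t)
    then have "{x \<star> y | x y. x \<in> derived_series (Suc t) \<and> y \<in> derived_series (Suc t)}
        \<subseteq> span (((``) E ^^ Suc t) Basis)"
      using mult_E[OF sub] by (simp add: subset_iff) blast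
    then show ?case
      unfolding derived_series.simps by (rule span_minimal) (rule subspace_span)
  qed
  from this[of "card Basis"] have "derived_series (Suc (card Basis)) \<subseteq> {0}"
    using acyclic_iterated_Image_empty[OF finite_Basis assms(1,2)] by simp
  moreover have "0 \<in> derived_series (Suc t)" for t
    by (cases t) (auto simp: span_zero)
  ultimately show ?thesis by blast
qed

lemma derived_series_eq_zero_if_no_oriented_cycle:
  assumes "\<not> has_oriented_cycle graph_R \<or> \<not> has_oriented_cycle graph_L"
  shows "derived_series (Suc (card Basis)) = {0}"
  using assms
proof
  assume "\<not> has_oriented_cycle graph_R"
  then have "acyclic (parcs graph_R)"
    by (rule acyclic_parcs_if_no_oriented_cycle[OF pair_wf_digraph_graph_R])
  moreover have "parcs graph_R \<subseteq> Basis \<times> Basis" by (auto simp: graph_R_def)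
  ultimately show ?thesis
    using derived_series_eq_zero_if_acyclic mult_mem_span_graph_R by blast
next
  assume "\<not> has_oriented_cycle graph_L"
  then have "acyclic (parcs graph_L)"
    by (rule acyclic_parcs_if_no_oriented_cycle[OF pair_wf_digraph_graph_L])
  moreover have "parcs graph_L \<subseteq> Basis \<times> Basis" by (auto simp: graph_L_def)
  ultimately show ?thesis
    using derived_series_eq_zero_if_acyclic mult_mem_span_graph_L by blast
qed

end

theorem theorem4p7:
  fixes scale :: "'k::{alg_closed_field, field_char_0} \<Rightarrow> 'v::ab_group_add \<Rightarrow> 'v"
    and Basis :: "'v set"
    and mult :: "'v \<Rightarrow> 'v \<Rightarrow> 'v"
  assumes "based_algebra scale Basis mult"
    and "\<not> has_oriented_cycle (based_algebra.graph_R scale Basis mult)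
       \<or> \<not> has_oriented_cycle (based_algebra.graph_L scale Basis mult)"
  shows "(\<exists>t\<ge>1. based_algebra.derived_series scale mult t = {0}) \<and>
    (based_algebra.leibniz mult \<longrightarrow> based_algebra.solvable scale mult)"
proof -
  interpret based_algebra scale Basis mult by fact
  have "\<exists>t\<ge>1. derived_series t = {0}"
    using derived_series_eq_zero_if_no_oriented_cycle[OF assms(2)]
    by (intro exI[of _ "Suc (card Basis)"]) simp
  then show ?thesis by (simp add: solvable_def)
qed

end
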